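(* Let $F:\mathbb{R}^d\to\mathbb{R}$ be a variationally coherent function with minimizer $x^*$. Assume the stochastic gradients satisfy $\mathbb{E}[g_t\mid\mathcal{F}_t]=\nabla F(x_t)$ and $\|g_t\|\le G$ almost surely for all $t\ge1$. Assume the learning rate $\eta_t$ is a non-negative $\mathcal{F}_t$-measurable random variable for each $t\ge1$, and that there is a real number $\gamma>0$ such that, almost surely, $$\sum_{t=1}^\infty \eta_t^2\|g_t\|^2<\gamma,\qquad \sum_{t=1}^\infty \eta_t=+\infty,\qquad \eta_t\le \frac1G\ \text{ for all } t\ge1 .$$ Then the iterates $x_1,x_2,\dots$ of Algorithm 1 (with arbitrary initial point $x_0\in\mathbb{R}^d$) satisfy $\lim_{t\to\infty}x_t=x^*$ almost surely.
   Context: $\|\cdot\|$ is the Euclidean norm on $\mathbb{R}^d$, $G>0$. A function $F:\mathbb{R}^d\to\mathbb{R}$ is variationally coherent if it is continuously differentiable, has a unique minimizer $x^*$, satisfies $\langle\nabla F(x),x-x^*\rangle\ge0$ for all $x\in\mathbb{R}^d$, with equality iff $x=x^*$. Setting: an algorithm outputs iterates $x_1,x_2,\dots$; after outputting $x_t$ it receives a random vector $g_t\in\mathbb{R}^d$ (stochastic gradient). $\mathcal{F}_t$ is the $\sigma$-algebra generated by $x_1,\dots,x_t,g_1,\dots,g_{t-1}$. Auxiliary functions: for $\theta\in\mathbb{R}$, $S>0$, $Q\ge0$, $\psi^*(\theta,S,Q)=\exp\big(\max_{\beta\in[-1/2,1/2]}(\theta\beta-\beta^2S^2)-Q\big)$,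 which equals $\exp(\theta^2/(4S^2)-Q)$ if $|\theta|\le S^2$ and $\exp(|\theta|/2-S^2/4-Q)$ if $|\theta|>S^2$; and $\psi(x,S,Q)=\sup_{\theta\in\mathbb{R}}(\theta x-\psi^*(\theta,S,Q))$. Algorithm 1 (input: $x_0\in\mathbb{R}^d$ and learning rates $\eta_1,\eta_2,\dots$): set $S_0^2=4$, $Q_0=0$, $\theta_0=0\in\mathbb{R}^d$. For $t=1,2,\dots$: output $x_t=x_0+\frac{\theta_{t-1}}{2S_{t-1}^2}\exp\big(\frac{\|\theta_{t-1}\|^2}{4S_{t-1}^2}-Q_{t-1}\big)$ if $\|\theta_{t-1}\|\le S_{t-1}^2$, and $x_t=x_0+\frac{\theta_{t-1}}{2\|\theta_{t-1}\|}\exp\big(\frac{\|\theta_{t-1}\|}{2}-\frac{S_{t-1}^2}{4}-Q_{t-1}\big)$ otherwise (equivalently, $x_t-x_0$ is the unique minimizer of $x\mapsto \psi(\|x\|,S_{t-1},Q_{t-1})-\langle\theta_{t-1},x\rangle$); receive $g_t$; set $\ell_t=\eta_tg_t$, $S_t^2=S_{t-1}^2+\|\ell_t\|^2$ ($S_t>0$), $Q_t=Q_{t-1}+\|\ell_t\|^2/S_t^2$, $\theta_t=\theta_{t-1}-\ell_t$. *)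

theory Defs
  imports "HOL-Probability.Probability"
begin

definition var_coherent :: "('a::euclidean_space \<Rightarrow> real) \<Rightarrow> ('a \<Rightarrow> 'a) \<Rightarrow> 'a \<Rightarrow> bool" where
  "var_coherent F F' xs \<longleftrightarrow>
     (\<forall>x. (F has_derivative (\<lambda>h. F' x \<bullet> h)) (at x)) \<and> continuous_on UNIV F' \<and>
     (\<forall>x. F xs \<le> F x) \<and> (\<forall>y. (\<forall>x. F y \<le> F x) \<longrightarrow> y = xs) \<and>
     (\<forall>x. F' x \<bullet> (x - xs) \<ge> 0) \<and>
     (\<forall>x. F' x \<bullet> (x - xs) = 0 \<longleftrightarrow> x = xs)"

text \<open>Internal state (theta_t, S_t^2, Q_t) of Algorithm 1 after t rounds, for a
  given realisation of learning rates eta and stochastic gradients g (indexed from 1).\<close>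
fun alg_state :: "(nat \<Rightarrow> real) \<Rightarrow> (nat \<Rightarrow> 'a::euclidean_space) \<Rightarrow> nat \<Rightarrow> 'a \<times> real \<times> real" where
  "alg_state eta g 0 = (0, 4, 0)"
| "alg_state eta g (Suc t) =
     (let (\<theta>, S2, Q) = alg_state eta g t;
          l = eta (Suc t) *\<^sub>R g (Suc t);
          S2' = S2 + (norm l)\<^sup>2
      in (\<theta> - l, S2', Q + (norm l)\<^sup>2 / S2'))"

definition alg_out :: "'a::euclidean_space \<Rightarrow> 'a \<times> real \<times> real \<Rightarrow> 'a" where
  "alg_out x0 st = (case st of (\<theta>, S2, Q) \<Rightarrow>
     (if norm \<theta> \<le> S2
      then x0 + (exp ((norm \<theta>)\<^sup>2 / (4 * S2) - Q) / (2 * S2)) *\<^sub>R \<theta>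
      else x0 + (exp (norm \<theta> / 2 - S2 / 4 - Q) / (2 * norm \<theta>)) *\<^sub>R \<theta>))"

fun alg_x :: "'a::euclidean_space \<Rightarrow> (nat \<Rightarrow> real) \<Rightarrow> (nat \<Rightarrow> 'a) \<Rightarrow> nat \<Rightarrow> 'a" where
  "alg_x x0 eta g 0 = x0"
| "alg_x x0 eta g (Suc t) = alg_out x0 (alg_state eta g t)"

definition gen_filt :: "'w measure \<Rightarrow> (nat \<Rightarrow> 'w \<Rightarrow> 'a::euclidean_space) \<Rightarrow> (nat \<Rightarrow> 'w \<Rightarrow> 'a) \<Rightarrow> nat \<Rightarrow> 'w measure" where
  "gen_filt M X g t = sigma (space M)
     ({X s -` B \<inter> space M | s B. s \<in> {1..t} \<and> B \<in> sets borel} \<union>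
      {g s -` B \<inter> space M | s B. s \<in> {1..<t} \<and> B \<in> sets borel})"

end

theory Submission
  imports Defs
begin

text \<open>With \<open>u = x\<^sup>* - x\<^sub>0\<close> and \<open>\<psi>\<^sup>*\<close> evaluated at the current state, the function
  \<open>L = \<psi>\<^sup>* - \<langle>\<theta>, u\<rangle>\<close> decreases in each round by at least \<open>\<langle>\<ell>\<^sub>t, x\<^sub>t - x\<^sup>*\<rangle>\<close>, so by coherence it is
  a supermartingale. Because \<open>S\<^sub>t\<close> and \<open>Q\<^sub>t\<close> stay bounded, \<open>L\<close> is bounded below and coercive in
  \<open>\<theta>\<close>. Hence \<open>L\<close> converges almost surely, \<open>\<theta>\<^sub>t\<close> stays bounded, and
  \<open>\<Sum> \<eta>\<^sub>t \<langle>\<nabla>F(x\<^sub>t), x\<^sub>t - x\<^sup>*\<rangle>\<close> is finite. As the learning rates are not summable, some subsequence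
  of \<open>x\<^sub>t\<close> tends to \<open>x\<^sup>*\<close>; since \<open>x\<^sub>t - x\<^sub>0\<close> is the gradient of \<open>\<psi>\<^sup>*\<close> and \<open>\<psi>\<^sup>*\<close> is convex, the
  limit of \<open>L\<close> is then the minimum of its limiting function. Every accumulation point of
  \<open>\<theta>\<^sub>t\<close> attains this minimum, hence has the same gradient, and so every accumulation point of \<open>x\<^sub>t\<close>
  equals \<open>x\<^sup>*\<close>.\<close>

subsection \<open>The potential and its one-step decrease\<close>

text \<open>\<open>dir s \<theta>\<close> maximises \<open>\<theta> \<bullet> c - s * (norm c)\<^sup>2\<close> over the ball \<open>norm c \<le> 1/2\<close>, with
  maximum \<open>hpot s \<theta>\<close>; thus \<open>exp (hpot s \<theta> - q)\<close> is the paper's \<open>\<psi>\<^sup>*\<close> at \<open>norm \<theta>\<close>, where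
  \<open>s\<close> stands for \<open>S\<^sup>2\<close>. This form covers both branches of the algorithm at once.\<close>

definition dir :: "real \<Rightarrow> 'a::euclidean_space \<Rightarrow> 'a" where
  "dir s \<theta> = (1 / (2 * max s (norm \<theta>))) *\<^sub>R \<theta>"

definition hpot :: "real \<Rightarrow> 'a::euclidean_space \<Rightarrow> real" where
  "hpot s \<theta> = \<theta> \<bullet> dir s \<theta> - s * (norm (dir s \<theta>))\<^sup>2"

lemma norm_dir_le: "s > 0 \<Longrightarrow> norm (dir s \<theta>) \<le> 1 / 2"
  by (auto simp: dir_def divide_simps max_def)

lemma scaleR_dir: "s > 0 \<Longrightarrow> (2 * max s (norm \<theta>)) *\<^sub>R dir s \<theta> = \<theta>"
  by (auto simp: dir_def max_def)

text \<open>The maximised function is quadratic with Hessian \<open>- 2 * s\<close> times the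
  identity, so first-order optimality on the ball makes its gap to the maximum at least
  \<open>s\<close> times the squared distance from the maximiser.\<close>

lemma hpot_strong_concave:
  assumes "s > 0" and "norm c \<le> 1 / 2"
  shows "\<theta> \<bullet> c - s * (norm c)\<^sup>2 + s * (norm (c - dir s \<theta>))\<^sup>2 \<le> hpot s \<theta>"
proof -
  define b where "b = dir s \<theta>"
  define m where "m = max s (norm \<theta>)"
  have \<theta>: "\<theta> = (2 * m) *\<^sub>R b"
    unfolding b_def m_def by (rule scaleR_dir[OF assms(1), symmetric])
  \<comment> \<open>Variational inequality at the maximiser: the gradient there is
    \<open>2 * (m - s)\<close> times \<open>b\<close>. It vanishes unless
    \<open>norm \<theta> > s\<close>, and then \<open>b\<close> lies on the sphere and the gradient
    points outwards.\<close>
  have "(m - s) * (b \<bullet> (c - b)) \<le> 0"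
  proof (cases "norm \<theta> \<le> s")
    case True
    then show ?thesis by (simp add: m_def)
  next
    case False
    then have "norm b = 1 / 2" using assms(1) by (auto simp: b_def dir_def max_def)
    then have "norm b * norm c \<le> norm b * norm b" using assms(2) by (intro mult_left_mono) auto
    with norm_cauchy_schwarz[of b c] have "b \<bullet> c \<le> b \<bullet> b"
      by (simp add: dot_square_norm power2_eq_square)
    then show ?thesis using False by (simp add: m_def inner_diff_right mult_le_0_iff)
  qed
  moreover have "\<theta> \<bullet> c - s * (norm c)\<^sup>2 + s * (norm (c - b))\<^sup>2 - (\<theta> \<bullet> b - s * (norm b)\<^sup>2)
      = 2 * ((m - s) * (b \<bullet> (c - b)))"
    unfolding \<theta> by (simp add: power2_norm_eq_inner inner_diff inner_commute algebra_simps)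
  ultimately show ?thesis by (simp add: hpot_def b_def)
qed

lemma hpot_ge:
  assumes "s > 0" and "norm c \<le> 1 / 2"
  shows "\<theta> \<bullet> c - s * (norm c)\<^sup>2 \<le> hpot s \<theta>"
proof -
  have "0 \<le> s * (norm (c - dir s \<theta>))\<^sup>2" using assms by simp
  with hpot_strong_concave[OF assms, of \<theta>] show ?thesis by linarith
qed

text \<open>The maximum is tested at the point of the sphere of radius 1/2 in the direction of
  \<open>\<theta>\<close>. This linear growth is the source of coercivity.\<close>

lemma hpot_ge_linear:
  assumes "s > 0"
  shows "norm \<theta> / 2 - s / 4 \<le> hpot s \<theta>"
proof (cases "\<theta> = 0")
  case True
  then show ?thesis using assms hpot_ge[of s 0 \<theta>] by simp
next
  case False
  define c where "c = (1 / (2 * norm \<theta>)) *\<^sub>R \<theta>"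
  have "\<theta> \<bullet> c = norm \<theta> / 2" and c: "norm c = 1 / 2"
    using False by (simp_all add: c_def dot_square_norm power2_eq_square)
  then show ?thesis using hpot_ge[OF assms, of c \<theta>] unfolding c by (simp add: power2_eq_square)
qed

lemma hpot_le:
  assumes "s > 0"
  shows "hpot s \<theta> \<le> norm \<theta> / 2"
proof -
  have "\<theta> \<bullet> dir s \<theta> \<le> norm \<theta> * norm (dir s \<theta>)" by (rule norm_cauchy_schwarz)
  also have "\<dots> \<le> norm \<theta> * (1 / 2)" by (intro mult_left_mono norm_dir_le assms norm_ge_zero)
  moreover have "0 \<le> s * (norm (dir s \<theta>))\<^sup>2" using assms by simp
  ultimately show ?thesis unfolding hpot_def by linarith
qed

text \<open>The derivative of \<open>ln (1 - z) + z + z\<^sup>2\<close> is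
  \<open>z * (1 - 2 * z) / (1 - z)\<close>, whose sign follows that of \<open>z\<close> on this
  interval, so the minimum is the value 0 at \<open>z = 0\<close>. The radius 1/2 of the ball keeps
  \<open>z\<close> in this range.\<close>

lemma exp_minus_minus_square_le:
  fixes z :: real
  assumes "\<bar>z\<bar> \<le> 1 / 2"
  shows "exp (- z - z\<^sup>2) \<le> 1 - z"
proof -
  define f where "f = (\<lambda>z::real. ln (1 - z) + z + z\<^sup>2)"
  have der: "(f has_real_derivative x * (1 - 2 * x) / (1 - x)) (at x)" if "\<bar>x\<bar> \<le> 1 / 2" for x
    unfolding f_def
    by (rule derivative_eq_intros refl | use that in \<open>force simp: field_simps power2_eq_square\<close>)+
  have "f 0 \<le> f z"
  proof (cases "z \<ge> 0")
    case True
    then show ?thesis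
    proof (rule DERIV_nonneg_imp_nondecreasing)
      fix x assume "0 \<le> x" "x \<le> z"
      then show "\<exists>y. (f has_real_derivative y) (at x) \<and> 0 \<le> y"
        using der[of x] assms by (intro exI[of _ "x * (1 - 2 * x) / (1 - x)"]) auto
    qed
  next
    case False
    then have "z \<le> 0" by simp
    then show ?thesis
    proof (rule DERIV_nonpos_imp_nonincreasing)
      fix x assume "z \<le> x" "x \<le> 0"
      then show "\<exists>y. (f has_real_derivative y) (at x) \<and> y \<le> 0"
        using der[of x] assms
        by (intro exI[of _ "x * (1 - 2 * x) / (1 - x)"])
           (auto intro!: divide_nonpos_pos mult_nonpos_nonneg)
    qed
  qed
  then have "- z - z\<^sup>2 \<le> ln (1 - z)" by (simp add: f_def)
  then have "exp (- z - z\<^sup>2) \<le> exp (ln (1 - z))" by simp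
  then show ?thesis using assms by simp
qed

text \<open>The old maximiser \<open>b\<close> is compared with the new one \<open>c\<close>. Strong
  concavity around \<open>b\<close> gains \<open>s * (norm (c - b))\<^sup>2\<close>, the growth of
  \<open>s\<close> pays for \<open>(l \<bullet> c)\<^sup>2\<close>, and the increment of
  \<open>q\<close> pays for the remainder.\<close>

lemma hpot_step:
  fixes \<theta> l :: "'a::euclidean_space"
  assumes s: "s > 0" and l: "norm l \<le> 1"
  defines "s' \<equiv> s + (norm l)\<^sup>2"
  shows "hpot s' (\<theta> - l) - (norm l)\<^sup>2 / s' \<le> hpot s \<theta> - l \<bullet> dir s \<theta> - (l \<bullet> dir s \<theta>)\<^sup>2"
proof -
  define b c m e where "b = dir s \<theta>" and "c = dir s' (\<theta> - l)" and "m = norm l" and "e = l \<bullet> b - l \<bullet> c"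
  have m: "0 \<le> m" "m \<le> 1" using l by (auto simp: m_def)
  have s': "s' > 0" using s by (simp add: s'_def add_pos_nonneg)
  have nb: "norm b \<le> 1 / 2" and nc: "norm c \<le> 1 / 2"
    using norm_dir_le s s' by (auto simp: b_def c_def)
  have bnd: "\<bar>l \<bullet> v\<bar> \<le> m / 2" if "norm v \<le> 1 / 2" for v
    using Cauchy_Schwarz_ineq2[of l v] mult_left_mono[OF that, of m] m by (simp add: m_def)
  note bb = bnd[OF nb] and bc = bnd[OF nc]
  have "hpot s' (\<theta> - l) = \<theta> \<bullet> c - l \<bullet> c - s * (norm c)\<^sup>2 - m\<^sup>2 * (norm c)\<^sup>2"
    by (simp add: hpot_def c_def s'_def m_def algebra_simps)
  also have "\<dots> \<le> hpot s \<theta> - s * (norm (c - b))\<^sup>2 - l \<bullet> c - m\<^sup>2 * (norm c)\<^sup>2"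
    using hpot_strong_concave[OF s nc, of \<theta>] by (simp add: b_def)
  finally have 1: "hpot s' (\<theta> - l) \<le> hpot s \<theta> - s * (norm (c - b))\<^sup>2 - l \<bullet> c - m\<^sup>2 * (norm c)\<^sup>2" .
  have 2: "(l \<bullet> c)\<^sup>2 \<le> m\<^sup>2 * (norm c)\<^sup>2"
    using Cauchy_Schwarz_ineq[of l c] by (simp add: m_def dot_square_norm)
  have 3: "e\<^sup>2 \<le> m\<^sup>2 * (norm (c - b))\<^sup>2"
    using Cauchy_Schwarz_ineq[of l "c - b"]
    by (simp add: m_def e_def dot_square_norm inner_diff_right power2_commute)
  \<comment> \<open>As \<open>s' = s + m\<^sup>2\<close>, the quadratic in \<open>e\<close> to be bounded has discriminant exactly 0.\<close>
  have 4: "e * (1 + l \<bullet> b + l \<bullet> c) \<le> s * (norm (c - b))\<^sup>2 + m\<^sup>2 / s'"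
  proof (cases "e \<le> 0 \<or> m = 0")
    case True
    then have "e * (1 + l \<bullet> b + l \<bullet> c) \<le> 0"
      using bb bc m by (auto simp: m_def e_def intro!: mult_nonpos_nonneg)
    moreover have "0 \<le> s * (norm (c - b))\<^sup>2 + m\<^sup>2 / s'" using s s' by simp
    ultimately show ?thesis by linarith
  next
    case False
    then have e: "e > 0" "m > 0" using m by auto
    \<comment> \<open>The bracket equals \<open>1 + 2 * (l \<bullet> b) - e\<close>, and
      \<open>l \<bullet> b \<le> 1 / 2\<close>.\<close>
    have "e * (1 + l \<bullet> b + l \<bullet> c) \<le> e * (2 - e)"
      using e bb m by (intro mult_left_mono) (auto simp: e_def)
    also have "e * (2 - e) \<le> s * e\<^sup>2 / m\<^sup>2 + m\<^sup>2 / s'"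
    proof -
      have "0 \<le> (s' * e - m\<^sup>2)\<^sup>2 / (m\<^sup>2 * s')" using s' by simp
      also have "\<dots> = s' * e\<^sup>2 / m\<^sup>2 - 2 * e + m\<^sup>2 / s'"
        using e s' by (simp add: power2_eq_square field_simps)
      also have "\<dots> = s * e\<^sup>2 / m\<^sup>2 + e\<^sup>2 - 2 * e + m\<^sup>2 / s'"
        using e by (simp add: s'_def m_def[symmetric] field_simps)
      finally show ?thesis by (simp add: power2_eq_square algebra_simps)
    qed
    also have "s * e\<^sup>2 / m\<^sup>2 \<le> s * (norm (c - b))\<^sup>2"
      using 3 e s by (simp add: divide_simps mult.commute mult.left_commute)
    finally show ?thesis by simp
  qed
  have "l \<bullet> b + (l \<bullet> b)\<^sup>2 - l \<bullet> c - (l \<bullet> c)\<^sup>2 = e * (1 + l \<bullet> b + l \<bullet> c)"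
    by (simp add: e_def power2_eq_square algebra_simps)
  with 1 2 4 show ?thesis by (simp add: b_def m_def)
qed

text \<open>The term \<open>(l \<bullet> dir s \<theta>)\<^sup>2\<close> gained before is spent on a
  factor affine in \<open>l\<close>; such a bound lets conditional expectation replace the
  stochastic gradient by the true one.\<close>

lemma exp_hpot_step:
  fixes \<theta> l :: "'a::euclidean_space"
  assumes "s > 0" and "norm l \<le> 1"
  defines "s' \<equiv> s + (norm l)\<^sup>2"
  shows "exp (hpot s' (\<theta> - l) - (q + (norm l)\<^sup>2 / s')) \<le> exp (hpot s \<theta> - q) * (1 - l \<bullet> dir s \<theta>)"
proof -
  define z where "z = l \<bullet> dir s \<theta>"
  have "norm l * norm (dir s \<theta>) \<le> 1 * (1 / 2)"
    using assms norm_dir_le[of s \<theta>] by (intro mult_mono) auto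
  then have "\<bar>z\<bar> \<le> 1 / 2" using Cauchy_Schwarz_ineq2[of l "dir s \<theta>"] by (simp add: z_def)
  then have z: "exp (- z - z\<^sup>2) \<le> 1 - z" by (rule exp_minus_minus_square_le)
  have "exp (hpot s' (\<theta> - l) - (q + (norm l)\<^sup>2 / s')) \<le> exp (hpot s \<theta> - q) * exp (- z - z\<^sup>2)"
    using hpot_step[OF assms(1,2), of \<theta>] by (simp add: s'_def z_def flip: exp_add)
  also have "\<dots> \<le> exp (hpot s \<theta> - q) * (1 - z)" using z by (intro mult_left_mono) auto
  finally show ?thesis by (simp add: z_def)
qed

text \<open>By the envelope theorem this is the gradient of \<open>exp (hpot s \<theta> - q)\<close>
  in \<open>\<theta>\<close>.\<close>

definition out_shift :: "'a::euclidean_space \<times> real \<times> real \<Rightarrow> 'a" where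
  "out_shift = (\<lambda>(\<theta>, s, q). exp (hpot s \<theta> - q) *\<^sub>R dir s \<theta>)"

definition lyap :: "'a::euclidean_space \<Rightarrow> 'a \<times> real \<times> real \<Rightarrow> real" where
  "lyap u = (\<lambda>(\<theta>, s, q). exp (hpot s \<theta> - q) - \<theta> \<bullet> u)"

lemma alg_out_eq:
  assumes "s > 0"
  shows "alg_out x0 (\<theta>, s, q) = x0 + out_shift (\<theta>, s, q)"
  using assms
  by (auto simp: alg_out_def out_shift_def hpot_def dir_def max_def dot_square_norm power2_eq_square
      intro!: arg_cong[where f = exp] split: if_splits)

lemma lyap_step:
  assumes "s > 0" and "norm l \<le> 1"
  shows "lyap u (\<theta> - l, s + (norm l)\<^sup>2, q + (norm l)\<^sup>2 / (s + (norm l)\<^sup>2))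
    \<le> lyap u (\<theta>, s, q) - l \<bullet> (out_shift (\<theta>, s, q) - u)"
  using exp_hpot_step[OF assms, of \<theta> q]
  by (simp add: lyap_def out_shift_def inner_diff algebra_simps)

text \<open>With \<open>u = out_shift (\<theta>, s, q)\<close>, the point \<open>\<theta>\<close>
  minimises \<open>lyap u\<close>. A second point on this level forces equality both in
  \<open>1 + z \<le> exp z\<close> and in strong concavity, hence the same exponent and the same
  maximiser.\<close>

lemma lyap_minimizer_unique:
  assumes s: "s > 0" and eq: "lyap (out_shift (\<theta>, s, q)) (\<theta>', s, q) = lyap (out_shift (\<theta>, s, q)) (\<theta>, s, q)"
  shows "out_shift (\<theta>', s, q) = out_shift (\<theta>, s, q)"
proof -
  define b b' h h' E where "b = dir s \<theta>" and "b' = dir s \<theta>'" and "h = hpot s \<theta>" and "h' = hpot s \<theta>'"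
    and "E = exp (h - q)"
  have "E > 0" by (simp add: E_def)
  have "exp (h' - q) - E * (\<theta>' \<bullet> b) = E - E * (\<theta> \<bullet> b)"
    using eq by (simp add: lyap_def out_shift_def b_def h_def h'_def E_def)
  moreover have "exp (h' - q) = E * exp (h' - h)" by (simp add: E_def flip: exp_add)
  ultimately have "E * exp (h' - h) = E * (1 + (\<theta>' \<bullet> b - \<theta> \<bullet> b))" by (simp add: algebra_simps)
  then have "exp (h' - h) = 1 + (\<theta>' \<bullet> b - \<theta> \<bullet> b)" using \<open>E > 0\<close> by simp
  moreover have strong: "\<theta>' \<bullet> b - s * (norm b)\<^sup>2 + s * (norm (b - b'))\<^sup>2 \<le> h'"
    unfolding h'_def b'_def b_def by (intro hpot_strong_concave s norm_dir_le)
  moreover have h: "h = \<theta> \<bullet> b - s * (norm b)\<^sup>2" by (simp add: h_def hpot_def b_def)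
  moreover have "1 + (h' - h) \<le> exp (h' - h)" by (rule exp_ge_add_one_self)
  moreover have "0 \<le> s * (norm (b - b'))\<^sup>2" using s by simp
  ultimately have "s * (norm (b - b'))\<^sup>2 = 0" and e: "exp (h' - h) = 1 + (h' - h)"
    by linarith+
  then have "b = b'" using s by simp
  moreover have "h' = h"
    using e ln_eq_minus_one[OF exp_gt_zero, of "h' - h", unfolded ln_exp] by auto
  ultimately show ?thesis by (simp add: out_shift_def b_def b'_def h_def h'_def)
qed

text \<open>\<open>B\<close> is uniform over all states with \<open>s / 4 + q\<close> at most
  \<open>C\<close>. The slope in \<open>norm \<theta>\<close> is \<open>K / 2 = norm u + 1\<close>,
  which leaves one \<open>norm \<theta>\<close> after \<open>\<theta> \<bullet> u\<close> is paid
  for.\<close>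

lemma lyap_coercive:
  fixes u :: "'a::euclidean_space"
  obtains B where "\<And>\<theta> s q. s > 0 \<Longrightarrow> s / 4 + q \<le> C \<Longrightarrow> norm \<theta> - B \<le> lyap u (\<theta>, s, q)"
proof -
  \<comment> \<open>The tangent line to the exponential with slope \<open>K\<close> already outgrows \<open>\<theta> \<bullet> u\<close>.\<close>
  define K where "K = 2 * norm u + 2"
  have K: "K > 0" by (simp add: K_def add_nonneg_pos)
  have "norm \<theta> - K * (C + ln K) \<le> lyap u (\<theta>, s, q)" if "s > 0" "s / 4 + q \<le> C" for \<theta> :: 'a and s q
  proof -
    have "norm \<theta> / 2 - C \<le> hpot s \<theta> - q" using hpot_ge_linear[of s \<theta>] that by linarith
    then have "K * (norm \<theta> / 2 - C - ln K) \<le> K * (hpot s \<theta> - q - ln K)" using K by simp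
    also have "\<dots> \<le> K * exp (hpot s \<theta> - q - ln K)"
      using K exp_ge_add_one_self[of "hpot s \<theta> - q - ln K"] by (intro mult_left_mono) linarith+
    also have "\<dots> = exp (hpot s \<theta> - q)" using K by (simp add: exp_diff)
    finally have "K * (norm \<theta> / 2 - C - ln K) \<le> exp (hpot s \<theta> - q)" .
    moreover have "\<theta> \<bullet> u \<le> norm \<theta> * norm u" by (rule norm_cauchy_schwarz)
    moreover have "K * (norm \<theta> / 2 - C - ln K) = norm \<theta> * norm u + norm \<theta> - K * (C + ln K)"
      by (simp add: K_def algebra_simps)
    ultimately show ?thesis by (simp add: lyap_def)
  qed
  then show ?thesis using that by blast
qed

subsection \<open>Convergence along a fixed trajectory\<close>

text \<open>Unrolling the recursion into partial sums reduces limits of the state to convergence of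
  series.\<close>

definition theta :: "(nat \<Rightarrow> 'a::euclidean_space) \<Rightarrow> nat \<Rightarrow> 'a" where
  "theta l n = - (\<Sum>k<n. l k)"

definition ssq :: "(nat \<Rightarrow> 'a::euclidean_space) \<Rightarrow> nat \<Rightarrow> real" where
  "ssq l n = 4 + (\<Sum>k<n. (norm (l k))\<^sup>2)"

definition qsum :: "(nat \<Rightarrow> 'a::euclidean_space) \<Rightarrow> nat \<Rightarrow> real" where
  "qsum l n = (\<Sum>k<n. (norm (l k))\<^sup>2 / ssq l (Suc k))"

definition state :: "(nat \<Rightarrow> 'a::euclidean_space) \<Rightarrow> nat \<Rightarrow> 'a \<times> real \<times> real" where
  "state l n = (theta l n, ssq l n, qsum l n)"

text \<open>The vectors \<open>l k\<close> are indexed from 0, the learning rates and gradients from 1.\<close>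
lemma alg_state_eq: "alg_state eta g n = state (\<lambda>k. eta (Suc k) *\<^sub>R g (Suc k)) n"
  by (induction n) (simp_all add: state_def theta_def ssq_def qsum_def Let_def)

lemma ssq_ge: "4 \<le> ssq l n"
  by (simp add: ssq_def sum_nonneg)

lemma ssq_pos: "0 < ssq l n"
  using ssq_ge[of l n] by linarith

lemma qsum_nonneg: "0 \<le> qsum l n"
  by (simp add: qsum_def sum_nonneg ssq_pos less_imp_le)

lemma qsum_term_le: "(norm (l k))\<^sup>2 / ssq l (Suc k) \<le> (norm (l k))\<^sup>2 / 4"
  by (intro divide_left_mono ssq_ge) (auto simp: ssq_pos)

lemma alg_x_Suc_eq:
  "alg_x x0 eta g (Suc n) = x0 + out_shift (state (\<lambda>k. eta (Suc k) *\<^sub>R g (Suc k)) n)"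
  by (simp add: alg_state_eq state_def alg_out_eq ssq_pos)

lemma lyap_state_Suc_le:
  assumes "norm (l n) \<le> 1"
  shows "lyap u (state l (Suc n)) \<le> lyap u (state l n) - l n \<bullet> (out_shift (state l n) - u)"
  using lyap_step[OF ssq_pos assms, of u "theta l n" l n "qsum l n"]
  by (simp add: state_def theta_def ssq_def qsum_def add.assoc)

text \<open>This bound and the next three grow with \<open>n\<close>; they serve only for
  integrability at a fixed time.\<close>

lemma norm_theta_le:
  assumes "\<And>k. norm (l k) \<le> 1"
  shows "norm (theta l n) \<le> n"
  using sum_norm_le[of "{..<n}" l "\<lambda>_. 1"] assms by (simp add: theta_def)

lemma exp_hpot_state_le:
  assumes "\<And>k. norm (l k) \<le> 1"
  shows "exp (hpot (ssq l n) (theta l n) - qsum l n) \<le> exp (n / 2)"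
  using hpot_le[OF ssq_pos, of l n "theta l n"] norm_theta_le[of l n, OF assms] qsum_nonneg[of l n]
  by simp

lemma norm_out_shift_state_le:
  assumes "\<And>k. norm (l k) \<le> 1"
  shows "norm (out_shift (state l n)) \<le> exp (n / 2)"
proof -
  have "norm (out_shift (state l n)) =
      exp (hpot (ssq l n) (theta l n) - qsum l n) * norm (dir (ssq l n) (theta l n))"
    by (simp add: out_shift_def state_def)
  also have "\<dots> \<le> exp (n / 2) * (1 / 2)"
    by (intro mult_mono exp_hpot_state_le norm_dir_le ssq_pos assms) auto
  also have "\<dots> \<le> exp (n / 2)" by simp
  finally show ?thesis .
qed

lemma abs_lyap_state_le:
  assumes "\<And>k. norm (l k) \<le> 1"
  shows "\<bar>lyap u (state l n)\<bar> \<le> exp (n / 2) + n * norm u"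
proof -
  have "\<bar>theta l n \<bullet> u\<bar> \<le> norm (theta l n) * norm u" by (rule Cauchy_Schwarz_ineq2)
  also have "\<dots> \<le> n * norm u" by (intro mult_right_mono norm_theta_le assms) auto
  finally have "\<bar>theta l n \<bullet> u\<bar> \<le> n * norm u" .
  moreover have "0 < exp (hpot (ssq l n) (theta l n) - qsum l n)" by (rule exp_gt_zero)
  moreover have "lyap u (state l n) = exp (hpot (ssq l n) (theta l n) - qsum l n) - theta l n \<bullet> u"
    by (simp add: lyap_def state_def)
  ultimately show ?thesis using exp_hpot_state_le[of l n, OF assms] by linarith
qed

text \<open>\<open>B\<close> depends on \<open>\<gamma>\<close> and \<open>u\<close> but not on the
  trajectory, so one deterministic shift makes the process non-negative.\<close>

lemma lyap_state_coercive:
  fixes u :: "'a::euclidean_space"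
  obtains B where
    "\<And>l n. summable (\<lambda>k. (norm (l k))\<^sup>2) \<Longrightarrow> (\<Sum>k. (norm (l k))\<^sup>2) \<le> \<gamma> \<Longrightarrow>
      norm (theta l n) - B \<le> lyap u (state l n)"
proof -
  \<comment> \<open>The constant adds \<open>ssq l n / 4 \<le> 1 + \<gamma> / 4\<close> to
    \<open>qsum l n \<le> \<gamma> / 4\<close>, the latter because every denominator is at least
    4.\<close>
  obtain B where B: "\<And>\<theta> s q. s > 0 \<Longrightarrow> s / 4 + q \<le> 1 + \<gamma> / 2 \<Longrightarrow> norm \<theta> - B \<le> lyap u (\<theta>, s, q)"
    using lyap_coercive[of "1 + \<gamma> / 2" u] by blast
  have "norm (theta l n) - B \<le> lyap u (state l n)"
    if "summable (\<lambda>k. (norm (l k))\<^sup>2)" "(\<Sum>k. (norm (l k))\<^sup>2) \<le> \<gamma>" for l :: "nat \<Rightarrow> 'a" and n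
  proof -
    have "(\<Sum>k<n. (norm (l k))\<^sup>2) \<le> \<gamma>"
      using sum_le_suminf[OF that(1), of "{..<n}"] that(2) by simp
    moreover have "qsum l n \<le> (\<Sum>k<n. (norm (l k))\<^sup>2) / 4"
      unfolding qsum_def sum_divide_distrib by (intro sum_mono qsum_term_le)
    ultimately have "ssq l n / 4 + qsum l n \<le> 1 + \<gamma> / 2" by (simp add: ssq_def field_simps)
    then show ?thesis unfolding state_def by (intro B ssq_pos)
  qed
  then show ?thesis using that by blast
qed

section \<open>Continuity of the potential and limits of the state\<close>

lemma tendsto_dir:
  assumes "(f \<longlongrightarrow> \<theta>) A" "(g \<longlongrightarrow> s) A" "s > 0"
  shows "((\<lambda>x. dir (g x) (f x)) \<longlongrightarrow> dir s \<theta>) A"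
  unfolding dir_def using assms by (auto intro!: tendsto_intros)

lemma tendsto_hpot:
  assumes "(f \<longlongrightarrow> \<theta>) A" "(g \<longlongrightarrow> s) A" "s > 0"
  shows "((\<lambda>x. hpot (g x) (f x)) \<longlongrightarrow> hpot s \<theta>) A"
  unfolding hpot_def using assms by (auto intro!: tendsto_intros tendsto_dir)

lemma tendsto_out_shift:
  assumes "(f \<longlongrightarrow> \<theta>) A" "(g \<longlongrightarrow> s) A" "(h \<longlongrightarrow> q) A" "s > 0"
  shows "((\<lambda>x. out_shift (f x, g x, h x)) \<longlongrightarrow> out_shift (\<theta>, s, q)) A"
  unfolding out_shift_def using assms by (auto intro!: tendsto_intros tendsto_dir tendsto_hpot)

lemma tendsto_lyap:
  assumes "(f \<longlongrightarrow> \<theta>) A" "(g \<longlongrightarrow> s) A" "(h \<longlongrightarrow> q) A" "s > 0"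
  shows "((\<lambda>x. lyap u (f x, g x, h x)) \<longlongrightarrow> lyap u (\<theta>, s, q)) A"
  unfolding lyap_def using assms by (auto intro!: tendsto_intros tendsto_hpot)

lemma ssq_tendsto:
  assumes "summable (\<lambda>k. (norm (l k))\<^sup>2)"
  shows "ssq l \<longlonglongrightarrow> 4 + (\<Sum>k. (norm (l k))\<^sup>2)"
  unfolding ssq_def by (intro tendsto_intros summable_LIMSEQ assms)

lemma qsum_tendsto:
  assumes "summable (\<lambda>k. (norm (l k))\<^sup>2)"
  shows "qsum l \<longlonglongrightarrow> (\<Sum>k. (norm (l k))\<^sup>2 / ssq l (Suc k))"
  unfolding qsum_def
proof (rule summable_LIMSEQ, rule summable_comparison_test')
  show "summable (\<lambda>k. (norm (l k))\<^sup>2 / 4)" using assms by (rule summable_divide)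
  show "norm ((norm (l k))\<^sup>2 / ssq l (Suc k)) \<le> (norm (l k))\<^sup>2 / 4" for k
    using qsum_term_le[of l k] ssq_pos[of l "Suc k"] by simp
qed

text \<open>If \<open>r\<close> stayed at or above \<open>\<epsilon>\<close> from \<open>N\<close>
  on, \<open>e\<close> would be dominated by the summable sequence
  \<open>e k * r k / \<epsilon>\<close>.\<close>

lemma not_summable_frequently_small:
  fixes e r :: "nat \<Rightarrow> real"
  assumes "\<And>k. 0 \<le> e k" "\<not> summable e" "summable (\<lambda>k. e k * r k)" "\<epsilon> > 0"
  shows "\<exists>n\<ge>N. r n < \<epsilon>"
proof (rule ccontr)
  assume *: "\<not> (\<exists>n\<ge>N. r n < \<epsilon>)"
  have "summable e"
  proof (rule summable_comparison_test')
    show "summable (\<lambda>k. e k * r k / \<epsilon>)" using assms(3) by (rule summable_divide)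
    show "norm (e k) \<le> e k * r k / \<epsilon>" if "k \<ge> N" for k
      using * that mult_right_mono[of \<epsilon> "r k" "e k"] assms(1)[of k] assms(4)
      by (simp add: field_simps not_less)
  qed
  with assms(2) show False by simp
qed

text \<open>The deterministic core: probability only has to supply these hypotheses for almost every
  trajectory. \<open>f\<close> stands for the inner product in the coherence condition, in
  coordinates centred at the initial point.\<close>

lemma out_shift_state_tendsto:
  fixes l :: "nat \<Rightarrow> 'a::euclidean_space" and f :: "'a \<Rightarrow> real" and e :: "nat \<Rightarrow> real"
  assumes sq: "summable (\<lambda>k. (norm (l k))\<^sup>2)"
    and lyap: "convergent (\<lambda>n. lyap u (state l n))"
    and bdd: "bounded (range (theta l))"
    and f: "continuous_on UNIV f" "\<And>x. 0 \<le> f x" "\<And>x. f x = 0 \<longleftrightarrow> x = u"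
    and e: "\<And>k. 0 \<le> e k" "\<not> summable e" "summable (\<lambda>k. e k * f (out_shift (state l k)))"
  shows "(\<lambda>n. out_shift (state l n)) \<longlonglongrightarrow> u"
proof -
  define s q where "s = 4 + (\<Sum>k. (norm (l k))\<^sup>2)" and "q = (\<Sum>k. (norm (l k))\<^sup>2 / ssq l (Suc k))"
  have lims: "ssq l \<longlonglongrightarrow> s" "qsum l \<longlonglongrightarrow> q"
    unfolding s_def q_def using sq by (rule ssq_tendsto, rule qsum_tendsto)
  have s: "s > 0" using suminf_nonneg[OF sq] by (simp add: s_def)
  obtain c where c: "(\<lambda>n. lyap u (state l n)) \<longlonglongrightarrow> c"
    using lyap by (auto simp: convergent_def)
  \<comment> \<open>Compactness: along any index sequence tending to infinity, some limit state is
    reached, and all such limit states lie on the same level \<open>c\<close>.\<close>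
  have subseq: "\<exists>r \<theta>. strict_mono (r :: nat \<Rightarrow> nat) \<and> lyap u (\<theta>, s, q) = c \<and>
      (\<lambda>k. out_shift (state l (\<tau> (r k)))) \<longlonglongrightarrow> out_shift (\<theta>, s, q)"
    if \<tau>: "filterlim \<tau> at_top sequentially" for \<tau> :: "nat \<Rightarrow> nat"
  proof -
    have "bounded (range (theta l \<circ> \<tau>))" using bdd by (rule bounded_subset) auto
    then obtain \<theta> r where r: "strict_mono (r :: nat \<Rightarrow> nat)" "((theta l \<circ> \<tau>) \<circ> r) \<longlonglongrightarrow> \<theta>"
      using bounded_imp_convergent_subsequence by blast
    have \<tau>r: "filterlim (\<lambda>k. \<tau> (r k)) at_top sequentially"
      using \<tau> filterlim_subseq[OF r(1)] by (rule filterlim_compose)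
    note lim = r(2)[unfolded comp_def] filterlim_compose[OF lims(1) \<tau>r] filterlim_compose[OF lims(2) \<tau>r]
    have "(\<lambda>k. lyap u (state l (\<tau> (r k)))) \<longlonglongrightarrow> lyap u (\<theta>, s, q)"
      unfolding state_def using lim s by (rule tendsto_lyap)
    then have "lyap u (\<theta>, s, q) = c" using filterlim_compose[OF c \<tau>r] by (rule LIMSEQ_unique)
    moreover have "(\<lambda>k. out_shift (state l (\<tau> (r k)))) \<longlonglongrightarrow> out_shift (\<theta>, s, q)"
      unfolding state_def using lim s by (rule tendsto_out_shift)
    ultimately show ?thesis using r(1) by blast
  qed
  \<comment> \<open>A limit state with gradient exactly \<open>u\<close>, found along rounds where
    \<open>f\<close> tends to 0; it shows that \<open>c\<close> is the minimum of
    \<open>lyap u\<close> at the limiting \<open>s\<close> and \<open>q\<close>.\<close>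
  obtain \<theta> where \<theta>: "lyap u (\<theta>, s, q) = c" "out_shift (\<theta>, s, q) = u"
  proof -
    have "\<forall>k. \<exists>n\<ge>k. f (out_shift (state l n)) < inverse (real (Suc k))"
      by (intro allI not_summable_frequently_small[OF e]) simp
    then obtain \<tau> where \<tau>: "\<And>k. k \<le> \<tau> k" "\<And>k. f (out_shift (state l (\<tau> k))) < inverse (real (Suc k))"
      by metis
    \<comment> \<open>The choice of \<open>\<tau>\<close> need not be monotone;
      \<open>k \<le> \<tau> k\<close> already sends it to infinity.\<close>
    have "filterlim \<tau> at_top sequentially"
      by (rule filterlim_at_top_mono[OF filterlim_ident]) (simp add: \<tau>)
    from subseq[OF this] obtain r \<theta> where r: "strict_mono (r :: nat \<Rightarrow> nat)" "lyap u (\<theta>, s, q) = c"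
        "(\<lambda>k. out_shift (state l (\<tau> (r k)))) \<longlonglongrightarrow> out_shift (\<theta>, s, q)"
      by blast
    have "(\<lambda>k. f (out_shift (state l (\<tau> (r k))))) \<longlonglongrightarrow> f (out_shift (\<theta>, s, q))"
      by (rule continuous_on_tendsto_compose[OF f(1) r(3)]) auto
    moreover have "(\<lambda>k. f (out_shift (state l (\<tau> (r k))))) \<longlonglongrightarrow> 0"
    proof (rule tendsto_sandwich[OF _ _ tendsto_const])
      show "(\<lambda>k. inverse (real (Suc (r k)))) \<longlonglongrightarrow> 0"
        using LIMSEQ_inverse_real_of_nat filterlim_subseq[OF r(1)] by (rule filterlim_compose)
    qed (auto simp: f(2) less_imp_le[OF \<tau>(2)] simp del: of_nat_Suc)
    ultimately have "f (out_shift (\<theta>, s, q)) = 0" by (rule LIMSEQ_unique)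
    then show thesis using that r(2) f(3) by blast
  qed
  show ?thesis
  proof (rule ccontr)
    \<comment> \<open>A subsequence staying \<open>\<epsilon>\<close> away from \<open>u\<close>
      would have a limit state on level \<open>c\<close>, whose gradient must again be
      \<open>u\<close>.\<close>
    assume "\<not> (\<lambda>n. out_shift (state l n)) \<longlonglongrightarrow> u"
    then obtain \<epsilon> where \<epsilon>: "\<epsilon> > 0" "\<And>N. \<exists>n\<ge>N. \<epsilon> \<le> dist (out_shift (state l n)) u"
      unfolding lim_sequentially by (metis not_less)
    then obtain \<tau> where \<tau>: "\<And>k. k \<le> \<tau> k" "\<And>k. \<epsilon> \<le> dist (out_shift (state l (\<tau> k))) u"
      by metis
    have "filterlim \<tau> at_top sequentially"
      by (rule filterlim_at_top_mono[OF filterlim_ident]) (simp add: \<tau>)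
    from subseq[OF this] obtain r \<theta>' where r: "lyap u (\<theta>', s, q) = c"
        "(\<lambda>k. out_shift (state l (\<tau> (r k)))) \<longlonglongrightarrow> out_shift (\<theta>', s, q)"
      by blast
    have "out_shift (\<theta>', s, q) = u"
      using lyap_minimizer_unique[OF s, of \<theta> q \<theta>'] \<theta> r(1) by simp
    with r(2) have "(\<lambda>k. out_shift (state l (\<tau> (r k)))) \<longlonglongrightarrow> u" by simp
    then have "\<forall>\<^sub>F k in sequentially. dist (out_shift (state l (\<tau> (r k)))) u < \<epsilon>"
      using \<epsilon>(1) by (rule tendstoD)
    then show False using \<tau>(2) by (auto simp: not_less[symmetric] eventually_sequentially)
  qed
qed

subsection \<open>Convergence of non-negative supermartingales\<close>

text \<open>The trading strategy ``buy below \<open>a\<close>, sell at or above \<open>b\<close>'': is an asset held from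
  time \<open>n\<close> to \<open>n + 1\<close>?\<close>
fun hold :: "real \<Rightarrow> real \<Rightarrow> (nat \<Rightarrow> real) \<Rightarrow> nat \<Rightarrow> bool" where
  "hold a b y 0 \<longleftrightarrow> y 0 < a"
| "hold a b y (Suc n) \<longleftrightarrow> (if hold a b y n then y (Suc n) < b else y (Suc n) < a)"

definition upcross :: "real \<Rightarrow> real \<Rightarrow> (nat \<Rightarrow> real) \<Rightarrow> nat \<Rightarrow> bool" where
  "upcross a b y n \<longleftrightarrow> hold a b y n \<and> b \<le> y (Suc n)"

text \<open>Every completed trade earns at least \<open>b - a\<close>, and a position still open was
  bought below \<open>a\<close>, so it has earned at least \<open>y n - a\<close>.\<close>

lemma upcross_gain:
  "(b - a) * (\<Sum>k<n. of_bool (upcross a b y k)) + (if hold a b y n then y n - a else 0)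
    \<le> (\<Sum>k<n. of_bool (hold a b y k) * (y (Suc k) - y k))"
  by (induction n) (auto simp: upcross_def algebra_simps)

text \<open>After the last sale, either a position is opened and kept forever, or none is ever
  opened again.\<close>

lemma eventually_not_upcross:
  assumes "\<forall>\<^sub>F n in sequentially. \<not> upcross a b y n"
  shows "(\<forall>\<^sub>F n in sequentially. a \<le> y n) \<or> (\<forall>\<^sub>F n in sequentially. y n < b)"
proof -
  obtain N where N: "\<And>n. n \<ge> N \<Longrightarrow> \<not> upcross a b y n"
    using assms by (auto simp: eventually_sequentially)
  show ?thesis
  proof (cases "\<exists>n\<ge>N. hold a b y n")
    case True
    then obtain m where m: "m \<ge> N" "hold a b y m" by blast
    have "hold a b y n \<and> y (Suc n) < b" if "n \<ge> m" for n
      using that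
    proof (induction n rule: dec_induct)
      case base
      then show ?case using N[of m] m by (auto simp: upcross_def)
    next
      case (step n)
      then show ?case using N[of "Suc n"] m by (auto simp: upcross_def)
    qed
    then have "\<forall>\<^sub>F n in sequentially. y (Suc n) < b" by (auto simp: eventually_sequentially)
    then show ?thesis using eventually_sequentially_Suc[of "\<lambda>n. y n < b"] by simp
  next
    case False
    then have "\<forall>\<^sub>F n in sequentially. a \<le> y (Suc n)"
      unfolding eventually_sequentially
      by (metis hold.simps(2) le_SucI linorder_not_le)
    then show ?thesis using eventually_sequentially_Suc[of "\<lambda>n. a \<le> y n"] by simp
  qed
qed

text \<open>Two rationals strictly between the lower and upper limits would contradict
  \<open>osc\<close>. The frequent bound, which a finite lower limit provides, excludes divergence
  to infinity.\<close>

lemma convergent_if_no_oscillation: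
  fixes y :: "nat \<Rightarrow> real"
  assumes nonneg: "\<And>n. 0 \<le> y n"
    and osc: "\<And>a b :: rat. a < b \<Longrightarrow>
      (\<forall>\<^sub>F n in sequentially. of_rat a \<le> y n) \<or> (\<forall>\<^sub>F n in sequentially. y n < of_rat b)"
    and bdd: "\<exists>\<^sub>F n in sequentially. y n \<le> K"
  shows "convergent y"
proof -
  define e where "e = (\<lambda>n. ereal (y n))"
  have "liminf e = limsup e"
  proof (rule ccontr)
    assume "liminf e \<noteq> limsup e"
    then have "liminf e < limsup e"
      using Liminf_le_Limsup[of sequentially e] by (simp add: order_less_le)
    then obtain a :: rat where a: "liminf e < real_of_rat a" "real_of_rat a < limsup e"
      using ereal_dense3 by blast
    then obtain b :: rat where b: "ereal (real_of_rat a) < real_of_rat b" "real_of_rat b < limsup e"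
      using ereal_dense3 by blast
    have "a < b" using b(1) by (simp add: of_rat_less)
    from osc[OF this] show False
    proof
      assume "\<forall>\<^sub>F n in sequentially. of_rat a \<le> y n"
      then have "real_of_rat a \<le> liminf e"
        by (intro Liminf_bounded) (auto simp: e_def elim: eventually_mono)
      with a show False by simp
    next
      assume "\<forall>\<^sub>F n in sequentially. y n < of_rat b"
      then have "limsup e \<le> real_of_rat b"
        by (intro Limsup_bounded) (auto simp: e_def elim: eventually_mono)
      with b show False by simp
    qed
  qed
  then have lim: "e \<longlonglongrightarrow> liminf e" by (intro Liminf_eq_Limsup) auto
  have "0 \<le> liminf e" by (intro Liminf_bounded) (simp add: e_def nonneg)
  moreover have "liminf e \<le> K"
  proof (rule ccontr)
    assume "\<not> liminf e \<le> K"
    then have "\<forall>\<^sub>F n in sequentially. ereal K < e n"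
      by (intro order_tendstoD(1)[OF lim]) simp
    then show False using bdd by (simp add: e_def frequently_def not_le)
  qed
  ultimately obtain r where "liminf e = ereal r" by (cases "liminf e") auto
  with lim show ?thesis by (auto simp: e_def convergent_def)
qed

lemma frequently_le_if_liminf_finite:
  fixes y :: "nat \<Rightarrow> real"
  assumes "liminf (\<lambda>n. ennreal (y n)) \<noteq> \<infinity>"
  shows "\<exists>K. \<exists>\<^sub>F n in sequentially. y n \<le> K"
proof (rule ccontr)
  assume *: "\<nexists>K. \<exists>\<^sub>F n in sequentially. y n \<le> K"
  obtain K where K: "liminf (\<lambda>n. ennreal (y n)) = ennreal K" "0 \<le> K"
    using assms by (cases "liminf (\<lambda>n. ennreal (y n))") auto
  have "\<forall>\<^sub>F n in sequentially. K + 1 \<le> y n"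
    using * by (simp add: not_frequently) (meson eventually_mono less_imp_le not_le)
  then have "ennreal (K + 1) \<le> liminf (\<lambda>n. ennreal (y n))"
    by (intro Liminf_bounded) (auto elim!: eventually_mono intro: ennreal_leI)
  with K show False by simp
qed

text \<open>The supermartingale inequality is put as integrals over sets of \<open>F n\<close>, the
  form in which the expected gain of a trading strategy is estimated.\<close>

locale nonneg_supermartingale = prob_space M for M :: "'w measure" +
  fixes F :: "nat \<Rightarrow> 'w measure" and Y :: "nat \<Rightarrow> 'w \<Rightarrow> real"
  assumes subalg: "\<And>n. subalgebra M (F n)"
    and mono: "\<And>n. sets (F n) \<subseteq> sets (F (Suc n))"
    and adapted: "\<And>n. Y n \<in> borel_measurable (F n)"
    and integrable: "\<And>n. integrable M (Y n)"
    and nonneg: "AE \<omega> in M. \<forall>n. 0 \<le> Y n \<omega>"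
    and super: "\<And>n A. A \<in> sets (F n) \<Longrightarrow>
      (\<integral>\<omega>. indicator A \<omega> * (Y (Suc n) \<omega> - Y n \<omega>) \<partial>M) \<le> 0"
begin

lemma space_F [simp]: "space (F n) = space M"
  using subalg by (simp add: subalgebra_def)

lemma sets_F: "A \<in> sets (F n) \<Longrightarrow> A \<in> sets M"
  using subalg by (auto simp: subalgebra_def)

lemma measurable_Y [measurable]: "Y n \<in> borel_measurable M"
  using integrable by (rule borel_measurable_integrable)

lemma less_set: "{\<omega> \<in> space M. Y n \<omega> < c} \<in> sets (F n)"
proof -
  have [measurable]: "Y n \<in> borel_measurable (F n)" by (rule adapted)
  have "{\<omega> \<in> space (F n). Y n \<omega> < c} \<in> sets (F n)" by measurable
  then show ?thesis by simp
qed

text \<open>Predictability: the position held from \<open>n\<close> to \<open>n + 1\<close> is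
  decided by time \<open>n\<close>, so \<open>super\<close> applies to it.\<close>

lemma hold_set: "{\<omega> \<in> space M. hold a b (\<lambda>k. Y k \<omega>) n} \<in> sets (F n)"
proof (induction n)
  case 0
  then show ?case by (simp add: less_set)
next
  case (Suc n)
  let ?A = "{\<omega> \<in> space M. hold a b (\<lambda>k. Y k \<omega>) n}"
  have "?A \<in> sets (F (Suc n))" using Suc mono by blast
  moreover have "{\<omega> \<in> space M. hold a b (\<lambda>k. Y k \<omega>) (Suc n)} =
      (?A \<inter> {\<omega> \<in> space M. Y (Suc n) \<omega> < b}) \<union> ({\<omega> \<in> space M. Y (Suc n) \<omega> < a} - ?A)"
    by auto
  ultimately show ?case using less_set by (simp add: sets.Un sets.Int sets.Diff)
qed

text \<open>Doob's upcrossing argument: the expected gain is at most 0, while an open position can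
  lose at most \<open>a\<close> because \<open>Y\<close> is non-negative.\<close>

lemma AE_finitely_many_upcrossings:
  assumes "a < b"
  shows "AE \<omega> in M. \<forall>\<^sub>F n in sequentially. \<not> upcross a b (\<lambda>k. Y k \<omega>) n"
proof (cases "a > 0")
  case True
  define H where "H = (\<lambda>n. {\<omega> \<in> space M. hold a b (\<lambda>k. Y k \<omega>) n})"
  define U where "U = (\<lambda>n. {\<omega> \<in> space M. upcross a b (\<lambda>k. Y k \<omega>) n})"
  have H [measurable]: "H n \<in> sets M" for n unfolding H_def by (rule sets_F[OF hold_set])
  have "U n = H n \<inter> {\<omega> \<in> space M. b \<le> Y (Suc n) \<omega>}" for n
    by (auto simp: U_def H_def upcross_def)
  then have U [measurable]: "U n \<in> sets M" for n by simp
  define W where "W = (\<lambda>n \<omega>. \<Sum>k<n. indicator (H k) \<omega> * (Y (Suc k) \<omega> - Y k \<omega>))"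
  have int: "integrable M (\<lambda>\<omega>. indicator (H k) \<omega> * (Y (Suc k) \<omega> - Y k \<omega>))" for k
    using integrable_mult_indicator[OF H Bochner_Integration.integrable_diff[OF integrable integrable]]
    by simp
  have bound: "(b - a) * (\<Sum>k<n. prob (U k)) \<le> a" for n
  proof -
    have "(\<integral>\<omega>. (b - a) * (\<Sum>k<n. indicator (U k) \<omega>) - a \<partial>M) \<le> (\<integral>\<omega>. W n \<omega> \<partial>M)"
    proof (rule integral_mono_AE)
      show "integrable M (\<lambda>\<omega>. (b - a) * (\<Sum>k<n. indicator (U k) \<omega>) - a)"
        by (intro Bochner_Integration.integrable_diff integrable_mult_right
            Bochner_Integration.integrable_sum integrable_const integrable_real_indicator U)
           (auto simp: emeasure_eq_measure)
      show "integrable M (W n)" unfolding W_def by (intro Bochner_Integration.integrable_sum int)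
      show "AE \<omega> in M. (b - a) * (\<Sum>k<n. indicator (U k) \<omega>) - a \<le> W n \<omega>"
        using nonneg AE_space
      proof eventually_elim
        case (elim \<omega>)
        have "(\<Sum>k<n. indicator (U k) \<omega>) = (\<Sum>k<n. of_bool (upcross a b (\<lambda>k. Y k \<omega>) k) :: real)"
          using elim by (intro sum.cong) (auto simp: U_def)
        moreover have "W n \<omega> = (\<Sum>k<n. of_bool (hold a b (\<lambda>k. Y k \<omega>) k) * (Y (Suc k) \<omega> - Y k \<omega>))"
          unfolding W_def using elim by (intro sum.cong) (auto simp: H_def)
        moreover have "0 \<le> Y n \<omega>" using elim(1) by (rule spec)
        ultimately show ?case
          using upcross_gain[of b a "\<lambda>k. Y k \<omega>" n] True by (simp split: if_splits)
      qed
    qed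
    also have "(\<integral>\<omega>. W n \<omega> \<partial>M) = (\<Sum>k<n. \<integral>\<omega>. indicator (H k) \<omega> * (Y (Suc k) \<omega> - Y k \<omega>) \<partial>M)"
      unfolding W_def by (rule Bochner_Integration.integral_sum) (rule int)
    also have "\<dots> \<le> 0" by (intro sum_nonpos super) (simp add: H_def hold_set)
    also have "(\<integral>\<omega>. (b - a) * (\<Sum>k<n. indicator (U k) \<omega>) - a \<partial>M) = (b - a) * (\<Sum>k<n. prob (U k)) - a"
      by (simp add: emeasure_eq_measure prob_space)
    finally show ?thesis by simp
  qed
  have "summable (\<lambda>n. prob (U n))"
  proof (rule bounded_imp_summable)
    show "(\<Sum>k\<le>n. prob (U k)) \<le> a / (b - a)" for n
      using bound[of "Suc n"] assms by (simp add: lessThan_Suc_atMost field_simps)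
  qed simp
  \<comment> \<open>The bound on the expected number of upcrossings makes their probabilities
    summable, so Borel-Cantelli applies.\<close>
  then have "AE \<omega> in M. \<forall>\<^sub>F n in sequentially. \<omega> \<in> space M - U n"
    by (intro borel_cantelli_AE1) (auto simp: emeasure_eq_measure)
  then show ?thesis by (rule AE_mp) (auto simp: U_def elim!: eventually_mono)
next
  case False
  \<comment> \<open>For \<open>a \<le> 0\<close> a non-negative process never falls below
    \<open>a\<close>, so nothing is ever bought.\<close>
  have "AE \<omega> in M. \<forall>n. \<not> upcross a b (\<lambda>k. Y k \<omega>) n"
    using nonneg
  proof eventually_elim
    case (elim \<omega>)
    have "\<not> hold a b (\<lambda>k. Y k \<omega>) n" for n
      using elim False by (induction n) (auto simp: not_less intro: order_trans[of a 0])
    then show ?case by (simp add: upcross_def)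
  qed
  then show ?thesis by (rule AE_mp) simp
qed

lemma expectation_le: "expectation (Y n) \<le> expectation (Y 0)"
proof (induction n)
  case (Suc n)
  have "(\<integral>\<omega>. indicator (space M) \<omega> * (Y (Suc n) \<omega> - Y n \<omega>) \<partial>M) \<le> 0"
    using sets.top[of "F n"] by (intro super) simp
  also have "(\<integral>\<omega>. indicator (space M) \<omega> * (Y (Suc n) \<omega> - Y n \<omega>) \<partial>M) = (\<integral>\<omega>. Y (Suc n) \<omega> - Y n \<omega> \<partial>M)"
    by (intro Bochner_Integration.integral_cong) auto
  also have "\<dots> = expectation (Y (Suc n)) - expectation (Y n)"
    by (rule Bochner_Integration.integral_diff[OF integrable integrable])
  finally show ?case using Suc by simp
qed simp

theorem AE_convergent: "AE \<omega> in M. convergent (\<lambda>n. Y n \<omega>)"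
proof -
  have "(\<integral>\<^sup>+\<omega>. ennreal (Y n \<omega>) \<partial>M) \<le> ennreal (expectation (Y 0))" for n
  proof -
    have "AE \<omega> in M. 0 \<le> Y n \<omega>" using nonneg by eventually_elim simp
    then show ?thesis
      using nn_integral_eq_integral[OF integrable, of n] expectation_le[of n] by (simp add: ennreal_leI)
  qed
  then have "liminf (\<lambda>n. \<integral>\<^sup>+\<omega>. ennreal (Y n \<omega>) \<partial>M) \<le> ennreal (expectation (Y 0))"
    by (intro Liminf_le) auto
  \<comment> \<open>Fatou's lemma: the lower limit has finite integral, hence is almost surely
    finite.\<close>
  with nn_integral_liminf[of "\<lambda>n \<omega>. ennreal (Y n \<omega>)" M]
  have "(\<integral>\<^sup>+\<omega>. liminf (\<lambda>n. ennreal (Y n \<omega>)) \<partial>M) \<le> ennreal (expectation (Y 0))"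
    by (auto intro: order_trans)
  then have "AE \<omega> in M. liminf (\<lambda>n. ennreal (Y n \<omega>)) \<noteq> \<infinity>"
    by (intro nn_integral_PInf_AE) (auto simp: top_unique)
  moreover have "AE \<omega> in M. \<forall>a b :: rat. a < b \<longrightarrow>
      (\<forall>\<^sub>F n in sequentially. \<not> upcross (of_rat a) (of_rat b) (\<lambda>k. Y k \<omega>) n)"
    unfolding AE_all_countable
  proof (intro allI)
    fix a b :: rat
    show "AE \<omega> in M. a < b \<longrightarrow>
        (\<forall>\<^sub>F n in sequentially. \<not> upcross (of_rat a) (of_rat b) (\<lambda>k. Y k \<omega>) n)"
      by (cases "a < b") (simp_all add: AE_finitely_many_upcrossings of_rat_less)
  qed
  ultimately show ?thesis using nonneg
  proof eventually_elim
    case (elim \<omega>)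
    then obtain K where "\<exists>\<^sub>F n in sequentially. Y n \<omega> \<le> K"
      using frequently_le_if_liminf_finite[OF elim(1)] by blast
    then show ?case
      using elim by (intro convergent_if_no_oscillation[of _ K] eventually_not_upcross) auto
  qed
qed

end

subsection \<open>Measurability and conditional expectations\<close>

lemma sets_gen_filt:
  "sets (gen_filt M X g t) = sigma_sets (space M)
     ({X s -` B \<inter> space M | s B. s \<in> {1..t} \<and> B \<in> sets borel} \<union>
      {g s -` B \<inter> space M | s B. s \<in> {1..<t} \<and> B \<in> sets borel})"
  unfolding gen_filt_def by (rule sets_measure_of) auto

lemma space_gen_filt [simp]: "space (gen_filt M X g t) = space M"
  unfolding gen_filt_def by (rule space_measure_of) auto

lemma gen_filt_mono:
  assumes "t \<le> t'"
  shows "sets (gen_filt M X g t) \<subseteq> sets (gen_filt M X g t')"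
proof -
  have "{1..t} \<subseteq> {1..t'}" "{1..<t} \<subseteq> {1..<t'}" using assms by auto
  then show ?thesis unfolding sets_gen_filt by (intro sigma_sets_mono' Un_mono) blast+
qed

lemma measurable_gen_filt_mono:
  assumes "f \<in> borel_measurable (gen_filt M X g t)" "t \<le> t'"
  shows "f \<in> borel_measurable (gen_filt M X g t')"
  using assms gen_filt_mono[OF assms(2), of M X g] by (auto simp: measurable_def)

lemma measurable_gen_filt_gradient:
  assumes "1 \<le> s" "s < t"
  shows "g s \<in> borel_measurable (gen_filt M X g t)"
proof (rule measurableI)
  fix B :: "'b set" assume "B \<in> sets borel"
  then show "g s -` B \<inter> space (gen_filt M X g t) \<in> sets (gen_filt M X g t)"
    unfolding sets_gen_filt space_gen_filt using assms
    by (intro sigma_sets.Basic UnI2 CollectI exI[of _ s] exI[of _ B] conjI) auto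
qed simp

text \<open>Measurability is asked only at the generating indices, so that it can be established for
  iterates and learning rates by a joint induction over time.\<close>

lemma subalgebra_gen_filt:
  assumes "\<And>s. 1 \<le> s \<Longrightarrow> s \<le> t \<Longrightarrow> X s \<in> borel_measurable M"
    and "\<And>s. 1 \<le> s \<Longrightarrow> s < t \<Longrightarrow> g s \<in> borel_measurable M"
  shows "subalgebra M (gen_filt M X g t)"
  unfolding subalgebra_def sets_gen_filt space_gen_filt
  by (intro conjI refl sets.sigma_sets_subset) (auto intro!: measurable_sets assms simp del: One_nat_def)

section \<open>Measurability of the state of the algorithm\<close>

lemma measurable_dir [measurable]:
  assumes [measurable]: "f \<in> borel_measurable N" "h \<in> borel_measurable N"
  shows "(\<lambda>\<omega>. dir (h \<omega>) (f \<omega>)) \<in> borel_measurable N"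
  unfolding dir_def by measurable

lemma measurable_hpot [measurable]:
  assumes [measurable]: "f \<in> borel_measurable N" "h \<in> borel_measurable N"
  shows "(\<lambda>\<omega>. hpot (h \<omega>) (f \<omega>)) \<in> borel_measurable N"
  unfolding hpot_def by measurable

lemma
  assumes "\<And>k. k < n \<Longrightarrow> (\<lambda>\<omega>. l \<omega> k) \<in> borel_measurable N"
  shows measurable_theta: "(\<lambda>\<omega>. theta (l \<omega>) n) \<in> borel_measurable N"
    and measurable_ssq: "(\<lambda>\<omega>. ssq (l \<omega>) n) \<in> borel_measurable N"
  unfolding theta_def ssq_def
  by (auto intro!: borel_measurable_uminus borel_measurable_sum borel_measurable_add
      borel_measurable_power measurable_compose[OF _ borel_measurable_norm] assms)

lemma measurable_qsum:
  assumes "\<And>k. k < n \<Longrightarrow> (\<lambda>\<omega>. l \<omega> k) \<in> borel_measurable N"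
  shows "(\<lambda>\<omega>. qsum (l \<omega>) n) \<in> borel_measurable N"
  unfolding qsum_def
  by (intro borel_measurable_sum borel_measurable_divide borel_measurable_power
      measurable_compose[OF _ borel_measurable_norm] measurable_ssq assms) auto

lemma
  assumes "\<And>k. k < n \<Longrightarrow> (\<lambda>\<omega>. l \<omega> k) \<in> borel_measurable N"
  shows measurable_out_shift_state: "(\<lambda>\<omega>. out_shift (state (l \<omega>) n)) \<in> borel_measurable N"
    and measurable_lyap_state: "(\<lambda>\<omega>. lyap u (state (l \<omega>) n)) \<in> borel_measurable N"
proof -
  note [measurable] = measurable_theta[of n, OF assms] measurable_ssq[of n, OF assms] measurable_qsum[of n, OF assms]
  show "(\<lambda>\<omega>. out_shift (state (l \<omega>) n)) \<in> borel_measurable N"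
    unfolding out_shift_def state_def prod.case by measurable
  show "(\<lambda>\<omega>. lyap u (state (l \<omega>) n)) \<in> borel_measurable N"
    unfolding lyap_def state_def prod.case by measurable
qed

text \<open>Coordinate by coordinate, the \<open>F\<close>-measurable factor is pulled out of the
  conditional expectation; the bound on the product of norms makes each coordinate product
  integrable.\<close>

lemma (in prob_space) expectation_cond_exp_inner:
  fixes g v gF :: "'a \<Rightarrow> 'b::euclidean_space"
  assumes F: "subalgebra M F"
    and v: "v \<in> borel_measurable F" and g: "g \<in> borel_measurable M"
    and bound: "AE \<omega> in M. norm (v \<omega>) * norm (g \<omega>) \<le> C"
    and cond: "\<And>b. b \<in> Basis \<Longrightarrow> AE \<omega> in M. real_cond_exp M F (\<lambda>\<omega>. g \<omega> \<bullet> b) \<omega> = gF \<omega> \<bullet> b"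
    and gF: "gF \<in> borel_measurable M"
  shows "integrable M (\<lambda>\<omega>. v \<omega> \<bullet> g \<omega>)" and "integrable M (\<lambda>\<omega>. v \<omega> \<bullet> gF \<omega>)"
    and "expectation (\<lambda>\<omega>. v \<omega> \<bullet> gF \<omega>) = expectation (\<lambda>\<omega>. v \<omega> \<bullet> g \<omega>)"
proof -
  interpret finite_measure_subalgebra M F by standard (rule F)
  note [measurable] = g gF measurable_from_subalg[OF F v] v
  have int: "integrable M (\<lambda>\<omega>. (v \<omega> \<bullet> b) * (g \<omega> \<bullet> b))" if b: "b \<in> Basis" for b
  proof (rule integrable_const_bound[where B = C])
    show "AE \<omega> in M. norm ((v \<omega> \<bullet> b) * (g \<omega> \<bullet> b)) \<le> C"
      using bound
    proof eventually_elim
      case (elim \<omega>)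
      have "\<bar>v \<omega> \<bullet> b\<bar> * \<bar>g \<omega> \<bullet> b\<bar> \<le> norm (v \<omega>) * norm (g \<omega>)"
        by (intro mult_mono Basis_le_norm b) auto
      with elim show ?case by (simp add: abs_mult)
    qed
  qed measurable
  have *: "AE \<omega> in M. (v \<omega> \<bullet> b) * real_cond_exp M F (\<lambda>\<omega>. g \<omega> \<bullet> b) \<omega> = (v \<omega> \<bullet> b) * (gF \<omega> \<bullet> b)"
    if "b \<in> Basis" for b
    using cond[OF that] by eventually_elim simp
  have int': "integrable M (\<lambda>\<omega>. (v \<omega> \<bullet> b) * (gF \<omega> \<bullet> b))"
    and eq: "expectation (\<lambda>\<omega>. (v \<omega> \<bullet> b) * (gF \<omega> \<bullet> b)) = expectation (\<lambda>\<omega>. (v \<omega> \<bullet> b) * (g \<omega> \<bullet> b))"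
    if b: "b \<in> Basis" for b
  proof -
    have vb: "(\<lambda>\<omega>. v \<omega> \<bullet> b) \<in> borel_measurable F" by measurable
    have gb: "(\<lambda>\<omega>. g \<omega> \<bullet> b) \<in> borel_measurable M" by measurable
    note intg = real_cond_exp_intg[OF int[OF b] vb gb]
    show "integrable M (\<lambda>\<omega>. (v \<omega> \<bullet> b) * (gF \<omega> \<bullet> b))"
      by (rule integrable_cong_AE_imp[OF intg(1)]) (use *[OF b] in auto)
    show "expectation (\<lambda>\<omega>. (v \<omega> \<bullet> b) * (gF \<omega> \<bullet> b)) = expectation (\<lambda>\<omega>. (v \<omega> \<bullet> b) * (g \<omega> \<bullet> b))"
      unfolding intg(2)[symmetric] by (rule integral_cong_AE) (use *[OF b] in auto)
  qed
  have inner: "(\<lambda>\<omega>. v \<omega> \<bullet> h \<omega>) = (\<lambda>\<omega>. \<Sum>b\<in>Basis. (v \<omega> \<bullet> b) * (h \<omega> \<bullet> b))" for h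
    by (rule ext) (rule euclidean_inner)
  show "integrable M (\<lambda>\<omega>. v \<omega> \<bullet> g \<omega>)" "integrable M (\<lambda>\<omega>. v \<omega> \<bullet> gF \<omega>)"
    "expectation (\<lambda>\<omega>. v \<omega> \<bullet> gF \<omega>) = expectation (\<lambda>\<omega>. v \<omega> \<bullet> g \<omega>)"
    unfolding inner using int int' by (simp_all add: Bochner_Integration.integral_sum eq)
qed

text \<open>By monotone convergence the sum of the series has integral at most \<open>C\<close>, so
  it is almost surely finite.\<close>

lemma (in prob_space) AE_summable_of_bounded_expectation:
  fixes D :: "nat \<Rightarrow> 'a \<Rightarrow> real"
  assumes int: "\<And>n. integrable M (D n)" and nonneg: "\<And>n. AE \<omega> in M. 0 \<le> D n \<omega>"
    and bound: "\<And>n. (\<Sum>k<n. expectation (D k)) \<le> C"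
  shows "AE \<omega> in M. summable (\<lambda>n. D n \<omega>)"
proof -
  have D [measurable]: "D n \<in> borel_measurable M" for n using int by (rule borel_measurable_integrable)
  have "(\<integral>\<^sup>+\<omega>. (\<Sum>n. ennreal (D n \<omega>)) \<partial>M) = (\<Sum>n. \<integral>\<^sup>+\<omega>. ennreal (D n \<omega>) \<partial>M)"
    by (rule nn_integral_suminf) simp
  also have "\<dots> = (\<Sum>n. ennreal (expectation (D n)))"
    by (simp add: nn_integral_eq_integral int nonneg)
  also have "\<dots> \<le> ennreal C"
    by (intro suminf_le_const) (auto simp: sum_ennreal integral_nonneg_AE nonneg intro!: ennreal_leI bound)
  finally have "(\<integral>\<^sup>+\<omega>. (\<Sum>n. ennreal (D n \<omega>)) \<partial>M) \<noteq> \<infinity>" by (auto simp: top_unique)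
  then have "AE \<omega> in M. (\<Sum>n. ennreal (D n \<omega>)) \<noteq> \<infinity>" by (intro nn_integral_PInf_AE) auto
  moreover have "AE \<omega> in M. \<forall>n. 0 \<le> D n \<omega>" using nonneg by (simp add: AE_all_countable)
  ultimately show ?thesis
    by eventually_elim (auto intro: summable_suminf_not_top)
qed

subsection \<open>Almost sure convergence\<close>

theorem theorem1:
  fixes M :: "'w measure" and F :: "'a::euclidean_space \<Rightarrow> real" and F' :: "'a \<Rightarrow> 'a"
    and xs x0 :: 'a and G \<gamma> :: real
    and g :: "nat \<Rightarrow> 'w \<Rightarrow> 'a" and eta :: "nat \<Rightarrow> 'w \<Rightarrow> real"
  defines "X \<equiv> (\<lambda>t \<omega>. alg_x x0 (\<lambda>s. eta s \<omega>) (\<lambda>s. g s \<omega>) t)"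
  defines "Filt \<equiv> gen_filt M X g"
  assumes "prob_space M"
    and "var_coherent F F' xs"
    and "G > 0" and "\<gamma> > 0"
    and "\<And>t. t \<ge> 1 \<Longrightarrow> g t \<in> borel_measurable M"
    and "\<And>t. t \<ge> 1 \<Longrightarrow> eta t \<in> borel_measurable (Filt t)"
    and "\<And>t. t \<ge> 1 \<Longrightarrow> AE \<omega> in M. eta t \<omega> \<ge> 0"
    and "\<And>t. t \<ge> 1 \<Longrightarrow> AE \<omega> in M. norm (g t \<omega>) \<le> G"
    and "\<And>t b. t \<ge> 1 \<Longrightarrow> b \<in> Basis \<Longrightarrow>
           AE \<omega> in M. real_cond_exp M (Filt t) (\<lambda>\<omega>. g t \<omega> \<bullet> b) \<omega> = F' (X t \<omega>) \<bullet> b"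
    and "AE \<omega> in M. summable (\<lambda>t. (eta (Suc t) \<omega>)\<^sup>2 * (norm (g (Suc t) \<omega>))\<^sup>2) \<and>
                      (\<Sum>t. (eta (Suc t) \<omega>)\<^sup>2 * (norm (g (Suc t) \<omega>))\<^sup>2) < \<gamma>"
    and "AE \<omega> in M. filterlim (\<lambda>n. \<Sum>t\<in>{1..n}. eta t \<omega>) at_top sequentially"
    and "AE \<omega> in M. \<forall>t\<ge>1. eta t \<omega> \<le> 1 / G"
  shows "AE \<omega> in M. (\<lambda>t. X t \<omega>) \<longlonglongrightarrow> xs"
proof -
  note g_meas = assms(7) and eta_meas = assms(8) and eta_nonneg = assms(9) and g_le = assms(10)
    and cond = assms(11) and sq_sum = assms(12) and eta_sum = assms(13) and eta_le = assms(14)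
  have G: "G > 0" by (rule assms(5))
  interpret prob_space M by (rule assms(3))
  define u where "u = xs - x0"
  define l where "l = (\<lambda>\<omega> k. eta (Suc k) \<omega> *\<^sub>R g (Suc k) \<omega>)"
  define x where "x = (\<lambda>n \<omega>. out_shift (state (l \<omega>) n))"
  have X_Suc: "X (Suc n) = (\<lambda>\<omega>. x0 + x n \<omega>)" for n
    by (simp add: X_def x_def l_def alg_x_Suc_eq del: alg_x.simps)
  have F'_cont: "continuous_on UNIV F'" and F'_nonneg: "\<And>y. 0 \<le> F' y \<bullet> (y - xs)"
    and F'_eq: "\<And>y. F' y \<bullet> (y - xs) = 0 \<longleftrightarrow> y = xs"
    using assms(4) by (simp_all add: var_coherent_def)

  have X_meas_aux: "X s \<in> borel_measurable M"
    if "1 \<le> s" "s \<le> Suc n" "\<And>k. k < n \<Longrightarrow> eta (Suc k) \<in> borel_measurable M" for s n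
  proof -
    obtain m where m: "s = Suc m" using \<open>1 \<le> s\<close> by (cases s) auto
    have "(\<lambda>\<omega>. l \<omega> k) \<in> borel_measurable M" if "k < m" for k
      unfolding l_def using that m \<open>s \<le> Suc n\<close>
      by (intro borel_measurable_scaleR g_meas) (simp_all add: \<open>\<And>k. k < n \<Longrightarrow> eta (Suc k) \<in> borel_measurable M\<close>)
    then show ?thesis unfolding m X_Suc x_def
      by (intro borel_measurable_add borel_measurable_const measurable_out_shift_state)
  qed
  \<comment> \<open>\<open>Filt (Suc n)\<close> lies below \<open>M\<close> once the iterates up to
    \<open>Suc n\<close> are measurable, and these involve only the learning rates up to
    \<open>n\<close>; strong induction avoids the circle.\<close>
  have eta_M: "eta (Suc n) \<in> borel_measurable M" for n
  proof (induction n rule: less_induct)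
    case (less n)
    have "subalgebra M (Filt (Suc n))"
      unfolding Filt_def by (intro subalgebra_gen_filt X_meas_aux[of _ n] g_meas less)
    then show ?case by (rule measurable_from_subalg) (simp add: eta_meas)
  qed
  have X_M: "X s \<in> borel_measurable M" if "1 \<le> s" for s
    using that by (rule X_meas_aux[of _ s]) (auto intro: eta_M)
  have sub: "subalgebra M (Filt t)" for t
    unfolding Filt_def by (intro subalgebra_gen_filt X_M g_meas)
  have l_meas: "(\<lambda>\<omega>. l \<omega> k) \<in> borel_measurable (Filt (Suc n))" if "k < n" for k n
    unfolding l_def
  proof (rule borel_measurable_scaleR)
    show "eta (Suc k) \<in> borel_measurable (Filt (Suc n))"
      using eta_meas[of "Suc k"] that unfolding Filt_def by (auto intro: measurable_gen_filt_mono)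
    show "g (Suc k) \<in> borel_measurable (Filt (Suc n))"
      using that unfolding Filt_def by (intro measurable_gen_filt_gradient) auto
  qed
  have x_meas: "x n \<in> borel_measurable (Filt (Suc n))" for n
    unfolding x_def by (intro measurable_out_shift_state l_meas)

  have nonneg_AE: "AE \<omega> in M. \<forall>k. 0 \<le> eta (Suc k) \<omega>"
    using eta_nonneg by (simp add: AE_all_countable)
  have g_AE: "AE \<omega> in M. \<forall>k. norm (g (Suc k) \<omega>) \<le> G"
    using g_le by (simp add: AE_all_countable)
  have bounds: "AE \<omega> in M. \<forall>k. 0 \<le> eta (Suc k) \<omega> \<and> eta (Suc k) \<omega> * norm (g (Suc k) \<omega>) \<le> 1"
    using nonneg_AE g_AE eta_le
  proof eventually_elim
    case (elim \<omega>)
    have "eta (Suc k) \<omega> * norm (g (Suc k) \<omega>) \<le> 1 / G * G" for k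
      using elim G by (intro mult_mono) auto
    with elim G show ?case by simp
  qed
  have l_le: "AE \<omega> in M. \<forall>k. norm (l \<omega> k) \<le> 1"
    using bounds by eventually_elim (simp add: l_def)

  obtain B where B: "\<And>l n. summable (\<lambda>k. (norm (l k))\<^sup>2) \<Longrightarrow> (\<Sum>k. (norm (l k))\<^sup>2) \<le> \<gamma> \<Longrightarrow>
      norm (theta l n) - B \<le> lyap u (state l n)"
    using lyap_state_coercive by blast
  have sq_AE: "AE \<omega> in M. summable (\<lambda>k. (norm (l \<omega> k))\<^sup>2) \<and> (\<Sum>k. (norm (l \<omega> k))\<^sup>2) \<le> \<gamma>"
    using sq_sum by eventually_elim (simp add: l_def power_mult_distrib)
  \<comment> \<open>\<open>Y n\<close> involves the gradients up to round \<open>n\<close>, so it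
    belongs to time \<open>Suc n\<close> of the filtration. \<open>D n\<close> will bound its
    conditional expected decrease from below.\<close>
  define Y where "Y = (\<lambda>n \<omega>. lyap u (state (l \<omega>) n) + B)"
  define D where "D = (\<lambda>n \<omega>. eta (Suc n) \<omega> * (F' (X (Suc n) \<omega>) \<bullet> (X (Suc n) \<omega> - xs)))"
  have Y_meas: "Y n \<in> borel_measurable (Filt (Suc n))" for n
    unfolding Y_def by (intro borel_measurable_add borel_measurable_const measurable_lyap_state l_meas)
  have Y_M [measurable]: "Y n \<in> borel_measurable M" for n
    using sub Y_meas by (rule measurable_from_subalg)
  have Y_int: "integrable M (Y n)" for n
  proof (rule integrable_const_bound[OF _ Y_M])
    show "AE \<omega> in M. norm (Y n \<omega>) \<le> exp (n / 2) + n * norm u + \<bar>B\<bar>"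
      using l_le
    proof eventually_elim
      case (elim \<omega>)
      then show ?case using abs_lyap_state_le[of "l \<omega>" u n] by (simp add: Y_def)
    qed
  qed
  have Y_nonneg: "AE \<omega> in M. \<forall>n. 0 \<le> Y n \<omega>"
    using sq_AE
  proof eventually_elim
    case (elim \<omega>)
    show ?case
    proof
      fix n
      have "norm (theta (l \<omega>) n) - B \<le> lyap u (state (l \<omega>) n)" using elim by (intro B) auto
      then show "0 \<le> Y n \<omega>" using norm_ge_zero[of "theta (l \<omega>) n"] unfolding Y_def by linarith
    qed
  qed
  have D_nonneg: "AE \<omega> in M. 0 \<le> D n \<omega>" for n
    using nonneg_AE by eventually_elim (simp add: D_def F'_nonneg)

  \<comment> \<open>Used twice: \<open>A = space M\<close> yields summability of the drift
    \<open>D\<close>, general \<open>A\<close> the supermartingale property of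
    \<open>Y\<close>.\<close>
  have step: "integrable M (\<lambda>\<omega>. indicator A \<omega> * D n \<omega>) \<and>
      expectation (\<lambda>\<omega>. indicator A \<omega> * (Y (Suc n) \<omega> - Y n \<omega>)) \<le> - expectation (\<lambda>\<omega>. indicator A \<omega> * D n \<omega>)"
    if A: "A \<in> sets (Filt (Suc n))" for A n
  proof -
    \<comment> \<open>All factors known before the gradient of round \<open>Suc n\<close> arrives;
      conditioning then turns \<open>g (Suc n)\<close> into \<open>F'\<close> at the
      iterate.\<close>
    define v where "v = (\<lambda>\<omega>. (indicator A \<omega> * eta (Suc n) \<omega>) *\<^sub>R (x n \<omega> - u))"
    have A_M: "A \<in> sets M" using A sub by (auto simp: subalgebra_def)
    have v_meas: "v \<in> borel_measurable (Filt (Suc n))"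
      unfolding v_def using A x_meas eta_meas[of "Suc n"]
      by (intro borel_measurable_scaleR borel_measurable_times borel_measurable_diff
          borel_measurable_indicator borel_measurable_const) auto
    have v_bound: "AE \<omega> in M. norm (v \<omega>) * norm (g (Suc n) \<omega>) \<le> exp (n / 2) + norm u"
      using bounds l_le
    proof eventually_elim
      case (elim \<omega>)
      have "norm (v \<omega>) * norm (g (Suc n) \<omega>)
          \<le> (eta (Suc n) \<omega> * norm (g (Suc n) \<omega>)) * norm (x n \<omega> - u)"
        using elim by (auto simp: v_def indicator_def mult_ac)
      also have "\<dots> \<le> 1 * norm (x n \<omega> - u)" using elim by (intro mult_right_mono) auto
      also have "\<dots> \<le> norm (x n \<omega>) + norm u" using norm_triangle_ineq4[of "x n \<omega>" u] by simp
      also have "\<dots> \<le> exp (n / 2) + norm u"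
        using norm_out_shift_state_le[of "l \<omega>" n] elim by (simp add: x_def)
      finally show ?case .
    qed
    have gF_meas: "(\<lambda>\<omega>. F' (X (Suc n) \<omega>)) \<in> borel_measurable M"
      using borel_measurable_continuous_onI[OF F'_cont] X_M[of "Suc n"] by (rule measurable_compose_rev) simp
    have n: "1 \<le> Suc n" by simp
    note inner = expectation_cond_exp_inner[OF sub v_meas g_meas[OF n] v_bound cond[OF n] gF_meas]
    have D_eq: "indicator A \<omega> * D n \<omega> = v \<omega> \<bullet> F' (X (Suc n) \<omega>)" for \<omega>
      by (simp add: D_def v_def X_Suc u_def inner_commute algebra_simps)
    have "expectation (\<lambda>\<omega>. indicator A \<omega> * (Y (Suc n) \<omega> - Y n \<omega>)) \<le> expectation (\<lambda>\<omega>. - (v \<omega> \<bullet> g (Suc n) \<omega>))"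
    proof (rule integral_mono_AE)
      show "integrable M (\<lambda>\<omega>. indicator A \<omega> * (Y (Suc n) \<omega> - Y n \<omega>))"
        using integrable_mult_indicator[OF A_M Bochner_Integration.integrable_diff[OF Y_int Y_int]] by simp
      show "integrable M (\<lambda>\<omega>. - (v \<omega> \<bullet> g (Suc n) \<omega>))" using inner(1) by simp
      show "AE \<omega> in M. indicator A \<omega> * (Y (Suc n) \<omega> - Y n \<omega>) \<le> - (v \<omega> \<bullet> g (Suc n) \<omega>)"
        using l_le
      proof eventually_elim
        case (elim \<omega>)
        have "Y (Suc n) \<omega> - Y n \<omega> \<le> - (l \<omega> n \<bullet> (x n \<omega> - u))"
          using lyap_state_Suc_le[of "l \<omega>" n u] elim by (simp add: Y_def x_def)
        then have "indicator A \<omega> * (Y (Suc n) \<omega> - Y n \<omega>) \<le> indicator A \<omega> * - (l \<omega> n \<bullet> (x n \<omega> - u))"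
          by (intro mult_left_mono) auto
        also have "\<dots> = - (v \<omega> \<bullet> g (Suc n) \<omega>)" by (simp add: v_def l_def inner_commute)
        finally show ?case .
      qed
    qed
    then show ?thesis using inner by (simp add: D_eq)
  qed

  have ind_space: "expectation (\<lambda>\<omega>. indicator (space M) \<omega> * h \<omega>) = expectation h"
    "integrable M (\<lambda>\<omega>. indicator (space M) \<omega> * h \<omega>) \<longleftrightarrow> integrable M h" for h :: "'w \<Rightarrow> real"
    by (auto intro!: Bochner_Integration.integral_cong Bochner_Integration.integrable_cong)
  have space_Filt: "space M \<in> sets (Filt t)" for t
    using sets.top[of "Filt t"] by (simp add: Filt_def)
  have D_int: "integrable M (D n)" for n
    using step[OF space_Filt, of n] by (simp add: ind_space)
  have Y_diff: "expectation (Y (Suc n)) + expectation (D n) \<le> expectation (Y n)" for n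
    using step[OF space_Filt, of n] by (simp add: ind_space Bochner_Integration.integral_diff[OF Y_int Y_int])
  \<comment> \<open>Telescoping; since \<open>Y\<close> is non-negative, the total expected drift is
    at most \<open>expectation (Y 0)\<close>.\<close>
  have Y_tele: "expectation (Y n) + (\<Sum>k<n. expectation (D k)) \<le> expectation (Y 0)" for n
  proof (induction n)
    case (Suc n)
    then show ?case using Y_diff[of n] by simp
  qed simp
  have D_summable: "AE \<omega> in M. summable (\<lambda>n. D n \<omega>)"
  proof (rule AE_summable_of_bounded_expectation[OF D_int D_nonneg])
    fix n
    have "0 \<le> expectation (Y n)"
      by (rule integral_nonneg_AE) (use Y_nonneg in \<open>auto elim: AE_mp\<close>)
    then show "(\<Sum>k<n. expectation (D k)) \<le> expectation (Y 0)" using Y_tele[of n] by linarith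
  qed

  interpret S: nonneg_supermartingale M "\<lambda>n. Filt (Suc n)" Y
  proof
    show "(\<integral>\<omega>. indicator A \<omega> * (Y (Suc n) \<omega> - Y n \<omega>) \<partial>M) \<le> 0" if A: "A \<in> sets (Filt (Suc n))" for n A
    proof -
      have "0 \<le> expectation (\<lambda>\<omega>. indicator A \<omega> * D n \<omega>)"
        by (rule integral_nonneg_AE) (use D_nonneg[of n] in eventually_elim, simp)
      with step[OF A] show ?thesis by linarith
    qed
    show "sets (Filt (Suc n)) \<subseteq> sets (Filt (Suc (Suc n)))" for n
      unfolding Filt_def by (rule gen_filt_mono) simp
  qed (use sub Y_meas Y_int Y_nonneg in auto)

  show ?thesis
    using S.AE_convergent D_summable nonneg_AE sq_AE eta_sum
  proof eventually_elim
    case (elim \<omega>)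
    obtain K where K: "\<And>n. \<bar>Y n \<omega>\<bar> \<le> K"
      using convergent_imp_Bseq[OF elim(1)] by (auto simp: Bseq_def)
    \<comment> \<open>The deterministic result is applied in coordinates \<open>y = x - x0\<close>,
      where the minimiser becomes \<open>u\<close>.\<close>
    have "(\<lambda>n. out_shift (state (l \<omega>) n)) \<longlonglongrightarrow> u"
    proof (rule out_shift_state_tendsto[where f = "\<lambda>y. F' (x0 + y) \<bullet> (y - u)" and e = "\<lambda>k. eta (Suc k) \<omega>"])
      show "summable (\<lambda>k. (norm (l \<omega> k))\<^sup>2)" using elim by blast
      show "convergent (\<lambda>n. lyap u (state (l \<omega>) n))"
        using convergent_diff[OF elim(1) convergent_const[of B]] by (simp add: Y_def)
      \<comment> \<open>Coercivity gives
        \<open>norm (theta (l \<omega>) n) \<le> Y n \<omega>\<close>, and the convergent sequence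
        \<open>Y\<close> is bounded.\<close>
      have "norm (theta (l \<omega>) n) \<le> K" for n
      proof -
        have "norm (theta (l \<omega>) n) - B \<le> lyap u (state (l \<omega>) n)" using elim by (intro B) auto
        then show ?thesis using K[of n] by (simp add: Y_def)
      qed
      then show "bounded (range (theta (l \<omega>)))" by (auto simp: bounded_iff)
      show "continuous_on UNIV (\<lambda>y. F' (x0 + y) \<bullet> (y - u))"
        by (intro continuous_on_inner continuous_on_compose2[OF F'_cont] continuous_intros) simp
      show "0 \<le> F' (x0 + y) \<bullet> (y - u)" for y
        using F'_nonneg[of "x0 + y"] by (simp add: u_def algebra_simps)
      show "F' (x0 + y) \<bullet> (y - u) = 0 \<longleftrightarrow> y = u" for y
        using F'_eq[of "x0 + y"] by (auto simp: u_def algebra_simps)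
      show "0 \<le> eta (Suc k) \<omega>" for k using elim by blast
      show "\<not> summable (\<lambda>k. eta (Suc k) \<omega>)"
      proof
        assume "summable (\<lambda>k. eta (Suc k) \<omega>)"
        then have "(\<lambda>n. \<Sum>k<n. eta (Suc k) \<omega>) \<longlonglongrightarrow> (\<Sum>k. eta (Suc k) \<omega>)" by (rule summable_LIMSEQ)
        then have "(\<lambda>n. \<Sum>t\<in>{1..n}. eta t \<omega>) \<longlonglongrightarrow> (\<Sum>k. eta (Suc k) \<omega>)"
          by (simp add: sum.atLeast1_atMost_eq)
        then show False
          using filterlim_at_top_imp_at_infinity[OF elim(5)]
          by (rule not_tendsto_and_filterlim_at_infinity[OF sequentially_bot])
      qed
      show "summable (\<lambda>k. eta (Suc k) \<omega> * (F' (x0 + out_shift (state (l \<omega>) k)) \<bullet> (out_shift (state (l \<omega>) k) - u)))"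
        using elim(2) by (simp add: D_def X_Suc x_def u_def algebra_simps)
    qed
    then have "(\<lambda>n. X (Suc n) \<omega>) \<longlonglongrightarrow> x0 + u"
      unfolding X_Suc x_def by (intro tendsto_intros)
    then have "(\<lambda>n. X n \<omega>) \<longlonglongrightarrow> x0 + u" by (rule LIMSEQ_imp_Suc)
    then show ?case by (simp add: u_def)
  qed
qed

end
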